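(* Let $R=\mathbb Z[u_{s,i}^{\pm1},u_{t,j}^{\pm1},u_{u,l}^{\pm1}]_{1\le i,j,l\le 2}$ and let $H_{G_{12}}$ be the associative unital $R$-algebra $$H_{G_{12}}=\Big\langle s,t,u\ \Big|\ stus=tust=ustu,\ \prod_{i=1}^2(s-u_{s,i})=\prod_{j=1}^2(t-u_{t,j})=\prod_{l=1}^2(u-u_{u,l})=0\Big\rangle .$$ Let $u_1,u_2,u_3$ be the $R$-subalgebras generated by $s$, $t$, $u$ respectively, let $z=(stu)^4$, and let $$U=\sum_{k=0}^1\big(z^ku_1u_3u_1u_2+z^ku_1u_2u_3u_2+z^ku_2u_3u_1u_2+z^ku_2u_1u_3u_2+z^ku_3u_2u_1u_2\big).$$ Then $H_{G_{12}}=U$.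
   Context: For subsets $X,Y$ of an $R$-algebra, $XY$ denotes the $R$-submodule spanned by the products $xy$. *)

theory Defs
  imports "HOL.Modules" "HOL-Library.Poly_Mapping" "HOL-Library.Set_Algebras"
begin

section \<open>The Laurent polynomial ring\<close>

datatype gen = S | T | U

datatype index = One | Two

text \<open>
  The ring of Laurent polynomials over the integers in the six variables \<open>u\<^bsub>g,i\<^esub>\<close>
  is the group ring over the integers of the free abelian group on the set \<open>gen \<times> index\<close>.
  The type \<open>gen \<times> index \<Rightarrow>\<^sub>0 int\<close> of exponents is this group, written additively;
  the exponents may be negative.
\<close>

type_synonym laurent = "(gen \<times> index \<Rightarrow>\<^sub>0 int) \<Rightarrow>\<^sub>0 int"

definition var :: "gen \<Rightarrow> index \<Rightarrow> laurent"
  where "var g i = Poly_Mapping.single (Poly_Mapping.single (g, i) 1) 1"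

definition var_inv :: "gen \<Rightarrow> index \<Rightarrow> laurent"
  where "var_inv g i = Poly_Mapping.single (Poly_Mapping.single (g, i) (- 1)) 1"

lemma var_mult_var_inv [simp]: "var g i * var_inv g i = 1" "var_inv g i * var g i = 1"
  by (simp_all add: var_def var_inv_def mult_single flip: single_add)


section \<open>The free algebra\<close>

lemma poly_mapping_single_induct [case_names zero add]:
  fixes f :: "'a \<Rightarrow>\<^sub>0 'b::comm_monoid_add"
  assumes "P 0" and "\<And>k v f. P f \<Longrightarrow> P (Poly_Mapping.single k v + f)"
  shows "P f"
proof (induction f rule: update_induct)
  case const
  show ?case by (rule assms(1))
next
  case (update f k v)
  have "Poly_Mapping.update k v f = Poly_Mapping.single k v + f"
    using update(1)
    by (intro poly_mapping_eqI) (auto simp: lookup_update lookup_add lookup_single in_keys_iff)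
  then show ?case using assms(2)[OF update(3)] by simp
qed

text \<open>
  The free associative unital algebra on \<open>gen\<close> is the monoid algebra of the free monoid on \<open>gen\<close>.
  Multiplication of finitely supported functions is convolution with respect to addition of
  the keys, so concatenation of words is written \<open>+\<close>.
\<close>

datatype word = Word (letters: "gen list")

instantiation word :: monoid_add
begin

definition zero_word :: word
  where "0 = Word []"

definition plus_word :: "word \<Rightarrow> word \<Rightarrow> word"
  where "v + w = Word (letters v @ letters w)"

instance
  by standard (simp_all add: zero_word_def plus_word_def)

end

type_synonym free_alg = "word \<Rightarrow>\<^sub>0 laurent"

definition free_gen :: "gen \<Rightarrow> free_alg"
  where "free_gen g = Poly_Mapping.single (Word [g]) 1"

definition free_const :: "laurent \<Rightarrow> free_alg"
  where "free_const r = Poly_Mapping.single 0 r"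

lemma free_const_central: "free_const r * x = x * free_const r"
proof (induction x rule: poly_mapping_single_induct)
  case zero
  show ?case by simp
next
  case (add k v f)
  then show ?case
    by (simp add: free_const_def mult_single mult.commute distrib_left distrib_right)
qed


section \<open>The Hecke algebra as a quotient of the free algebra\<close>

definition two_sided_ideal :: "'a::ring_1 set \<Rightarrow> bool"
  where "two_sided_ideal I \<longleftrightarrow>
    0 \<in> I \<and> (\<forall>x\<in>I. \<forall>y\<in>I. x + y \<in> I) \<and> (\<forall>x\<in>I. \<forall>a. a * x \<in> I \<and> x * a \<in> I)"

lemma two_sided_ideal_hull: "two_sided_ideal (two_sided_ideal hull X)"
  by (rule hull_in) (auto simp: two_sided_ideal_def)

definition relators :: "free_alg set"
  where "relators =
    {free_gen S * free_gen T * free_gen U * free_gen S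
       - free_gen T * free_gen U * free_gen S * free_gen T,
     free_gen T * free_gen U * free_gen S * free_gen T
       - free_gen U * free_gen S * free_gen T * free_gen U}
    \<union> {(free_gen g - free_const (var g One)) * (free_gen g - free_const (var g Two)) | g. True}"

text \<open>A ring ideal of the free algebra is automatically a submodule, as the scalars lie in it.\<close>

definition relations :: "free_alg set"
  where "relations = two_sided_ideal hull relators"

lemma relations_0: "0 \<in> relations"
  and relations_add: "x \<in> relations \<Longrightarrow> y \<in> relations \<Longrightarrow> x + y \<in> relations"
  and relations_left: "x \<in> relations \<Longrightarrow> a * x \<in> relations"
  and relations_right: "x \<in> relations \<Longrightarrow> x * a \<in> relations"
  using two_sided_ideal_hull[of relators] by (auto simp: relations_def two_sided_ideal_def)

lemma relations_minus: "x \<in> relations \<Longrightarrow> - x \<in> relations"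
  using relations_left[of x "- 1"] by simp

lemma relators_subset: "relators \<subseteq> relations"
  by (simp add: relations_def hull_subset)

text \<open>
  The instance of \<open>ring_1\<close> below needs \<open>1 \<notin> relations\<close>. The ring homomorphism to the
  integers that maps all generators and all parameters to 1 annihilates the relations.
\<close>

definition aug :: "('a \<Rightarrow>\<^sub>0 'b::comm_monoid_add) \<Rightarrow> 'b"
  where "aug f = (\<Sum>k\<in>Poly_Mapping.keys f. Poly_Mapping.lookup f k)"

lemma aug_superset: "finite A \<Longrightarrow> Poly_Mapping.keys f \<subseteq> A \<Longrightarrow> aug f = (\<Sum>k\<in>A. Poly_Mapping.lookup f k)"
  unfolding aug_def by (rule sum.mono_neutral_left) (auto simp: in_keys_iff)

lemma aug_single [simp]: "aug (Poly_Mapping.single k v) = v"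
  by (simp add: aug_superset[of "{k}"])

lemma aug_0 [simp]: "aug 0 = 0"
  by (simp add: aug_def)

lemma aug_1 [simp]: "aug 1 = (1::'b::semiring_1)"
  using aug_single[of 0 "1::'b"] by (simp del: aug_single)

lemma aug_add [simp]: "aug (f + g) = aug f + aug g"
  using Poly_Mapping.keys_add[of f g]
  by (simp add: aug_superset[of "Poly_Mapping.keys f \<union> Poly_Mapping.keys g"] lookup_add sum.distrib)

lemma aug_diff [simp]: "aug (f - g) = aug f - (aug g :: 'b::ab_group_add)"
  using aug_add[of "f - g" g] by (simp del: aug_add)

lemma aug_mult [simp]: "aug (f * g) = aug f * (aug g :: 'b::semiring_0)"
proof (induction f rule: poly_mapping_single_induct)
  case zero
  show ?case by simp
next
  case (add k v f)
  have "aug (Poly_Mapping.single k v * g) = v * aug g"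
    by (induction g rule: poly_mapping_single_induct) (simp_all add: mult_single distrib_left)
  with add show ?case by (simp add: distrib_right)
qed

lemma one_notin_relations: "1 \<notin> relations"
proof -
  have "relators \<subseteq> {x. aug (aug x) = 0}"
    by (auto simp: relators_def free_gen_def free_const_def var_def)
  moreover have "two_sided_ideal {x :: free_alg. aug (aug x) = 0}"
    by (simp add: two_sided_ideal_def)
  ultimately have "relations \<subseteq> {x. aug (aug x) = 0}"
    unfolding relations_def by (rule hull_minimal)
  then show ?thesis by auto
qed

definition cong_rel :: "free_alg \<Rightarrow> free_alg \<Rightarrow> bool"
  where "cong_rel x y \<longleftrightarrow> x - y \<in> relations"

lemma equivp_cong_rel: "equivp cong_rel"
proof (rule equivpI)
  show "reflp cong_rel"
    by (rule reflpI) (simp add: cong_rel_def relations_0)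
  show "symp cong_rel"
  proof (rule sympI)
    fix x y assume "cong_rel x y"
    then show "cong_rel y x"
      using relations_minus[of "x - y"] by (simp add: cong_rel_def)
  qed
  show "transp cong_rel"
  proof (rule transpI)
    fix x y z assume "cong_rel x y" "cong_rel y z"
    then show "cong_rel x z"
      using relations_add[of "x - y" "y - z"] by (simp add: cong_rel_def)
  qed
qed

quotient_type hecke = free_alg / cong_rel
  by (rule equivp_cong_rel)

instantiation hecke :: ring_1
begin

lift_definition zero_hecke :: hecke is 0 .

lift_definition one_hecke :: hecke is 1 .

lift_definition plus_hecke :: "hecke \<Rightarrow> hecke \<Rightarrow> hecke" is "(+)"
proof -
  fix a b c d :: free_alg
  assume "cong_rel a b" "cong_rel c d"
  then show "cong_rel (a + c) (b + d)"
    using relations_add[of "a - b" "c - d"] by (simp add: cong_rel_def algebra_simps)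
qed

lift_definition uminus_hecke :: "hecke \<Rightarrow> hecke" is uminus
proof -
  fix a b :: free_alg
  assume "cong_rel a b"
  then show "cong_rel (- a) (- b)"
    using relations_minus[of "a - b"] by (simp add: cong_rel_def)
qed

lift_definition minus_hecke :: "hecke \<Rightarrow> hecke \<Rightarrow> hecke" is "(-)"
proof -
  fix a b c d :: free_alg
  assume "cong_rel a b" "cong_rel c d"
  then show "cong_rel (a - c) (b - d)"
    using relations_add[OF _ relations_minus, of "a - b" "c - d"]
    by (simp add: cong_rel_def algebra_simps)
qed

lift_definition times_hecke :: "hecke \<Rightarrow> hecke \<Rightarrow> hecke" is "(*)"
proof -
  fix a b c d :: free_alg
  assume *: "cong_rel a b" "cong_rel c d"
  have "a * c - b * d = (a - b) * c + b * (c - d)"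
    by (simp add: algebra_simps)
  then show "cong_rel (a * c) (b * d)"
    using * by (simp add: cong_rel_def relations_add relations_left relations_right)
qed

instance
proof
  show "(0::hecke) \<noteq> 1"
  proof (transfer, rule notI)
    assume "cong_rel 0 1"
    then show False
      using relations_minus[of "- 1"] one_notin_relations by (simp add: cong_rel_def)
  qed
qed (transfer; simp add: cong_rel_def relations_0 algebra_simps)+

end

lift_definition hecke_gen :: "gen \<Rightarrow> hecke" is free_gen .

lift_definition scale_hecke :: "laurent \<Rightarrow> hecke \<Rightarrow> hecke"
  is "\<lambda>r x. free_const r * x"
  unfolding cong_rel_def by (metis relations_left right_diff_distrib)

lemma free_const_add: "free_const (a + b) = free_const a + free_const b"
  and free_const_mult: "free_const (a * b) = free_const a * free_const b"
  and free_const_1: "free_const 1 = 1"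
  by (simp_all add: free_const_def single_add mult_single)

global_interpretation hecke: module scale_hecke
  by standard
    (transfer; simp add: cong_rel_def relations_0 free_const_add free_const_mult free_const_1 
       algebra_simps)+

lemma scale_mult_left: "scale_hecke r x * y = scale_hecke r (x * y)"
  by transfer (simp add: cong_rel_def relations_0 mult.assoc)

lemma scale_mult_right: "x * scale_hecke r y = scale_hecke r (x * y)"
  by transfer (simp add: cong_rel_def relations_0 free_const_central mult.assoc 
     flip: mult.assoc[of _ "free_const r"])

lemma cong_rel_relator: "x - y \<in> relators \<Longrightarrow> cong_rel x y"
  using relators_subset by (auto simp: cong_rel_def)

lemma braid_relations:
  "hecke_gen S * hecke_gen T * hecke_gen U * hecke_gen S = hecke_gen T * hecke_gen U * hecke_gen S * hecke_gen T"
  "hecke_gen T * hecke_gen U * hecke_gen S * hecke_gen T = hecke_gen U * hecke_gen S * hecke_gen T * hecke_gen U"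
  by (transfer, rule cong_rel_relator, simp add: relators_def)+

lemma quadratic_relations:
  "(hecke_gen g - scale_hecke (var g One) 1) * (hecke_gen g - scale_hecke (var g Two) 1) = 0"
  by transfer (rule cong_rel_relator, auto simp: relators_def)


section \<open>Subalgebras and products of submodules\<close>

definition subalgebra :: "hecke set \<Rightarrow> bool"
  where "subalgebra A \<longleftrightarrow> hecke.subspace A \<and> 1 \<in> A \<and> (\<forall>x\<in>A. \<forall>y\<in>A. x * y \<in> A)"

definition u1 :: "hecke set" where "u1 = subalgebra hull {hecke_gen S}"
definition u2 :: "hecke set" where "u2 = subalgebra hull {hecke_gen T}"
definition u3 :: "hecke set" where "u3 = subalgebra hull {hecke_gen U}"

definition z :: hecke
  where "z = (hecke_gen S * hecke_gen T * hecke_gen U) ^ 4"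

definition span_prod :: "hecke set \<Rightarrow> hecke set \<Rightarrow> hecke set"  (infixl \<open>\<odot>\<close> 70)
  where "X \<odot> Y = hecke.span {x * y | x y. x \<in> X \<and> y \<in> Y}"

end

theory Submission
  imports Defs
begin

text \<open>
  Call the right-hand side \<open>V\<close>. It contains 1 and is closed under right multiplication by \<open>t\<close>, so it
  suffices to show that it is closed under left multiplication by \<open>s\<close>, \<open>t\<close> and \<open>u\<close>. For braids \<open>p\<close>,
  \<open>q\<close> and a generator \<open>g\<close>, the quadratic relation makes \<open>p g q\<close> a linear combination of \<open>p q\<close> and
  \<open>p g\<^sup>-\<^sup>1 q\<close>, and similarly with \<open>g\<close> and \<open>g\<^sup>-\<^sup>1\<close> exchanged. So if \<open>p q\<close> and one of \<open>p g\<^sup>\<plusminus>\<^sup>1 q\<close> lie in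
  \<open>V\<close>, so does the other. This inference, applied repeatedly to the braids that visibly lie in \<open>V\<close>,
  produces \<open>s V \<subseteq> V\<close>, then \<open>t V \<subseteq> V\<close> and \<open>u V \<subseteq> V\<close>. The inferences were found by a computer search;
  to compare braids, one writes the braid group as \<open>\<langle>X, Y | X\<^sup>3 = Y\<^sup>4\<rangle>\<close> with \<open>X = stus\<close>, \<open>Y = stu\<close>.
\<close>

section \<open>Braid words\<close>

datatype letter = Pos gen | Neg gen

primrec letter_gen :: "letter \<Rightarrow> gen" where
  "letter_gen (Pos g) = g"
| "letter_gen (Neg g) = g"

primrec letter_inv :: "letter \<Rightarrow> letter" where
  "letter_inv (Pos g) = Neg g"
| "letter_inv (Neg g) = Pos g"

lemma letter_gen_inv [simp]: "letter_gen (letter_inv l) = letter_gen l"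
  by (cases l) simp_all

lemma letter_inv_inv [simp]: "letter_inv (letter_inv l) = l"
  by (cases l) simp_all

definition gen_trace :: "gen \<Rightarrow> laurent"
  where "gen_trace g = var g One + var g Two"

definition gen_norm :: "gen \<Rightarrow> laurent"
  where "gen_norm g = var g One * var g Two"

definition gen_norm_inv :: "gen \<Rightarrow> laurent"
  where "gen_norm_inv g = var_inv g One * var_inv g Two"

lemma gen_norm_inv [simp]: "gen_norm g * gen_norm_inv g = 1" "gen_norm_inv g * gen_norm g = 1"
proof -
  have "gen_norm g * gen_norm_inv g = (var g One * var_inv g One) * (var g Two * var_inv g Two)"
    by (simp only: gen_norm_def gen_norm_inv_def ac_simps)
  then show "gen_norm g * gen_norm_inv g = 1" by simp
  then show "gen_norm_inv g * gen_norm g = 1" by (simp add: mult.commute)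
qed

lemma gen_norm_cancel [simp]:
  "gen_norm g * (gen_norm_inv g * r) = r" "gen_norm_inv g * (gen_norm g * r) = r"
  by (simp_all flip: mult.assoc)

text \<open>The quadratic relation expands to \<open>g * (gen_trace g - g) = gen_norm g\<close> with
  a unit on the right, so the \<open>Neg\<close> clause is the inverse of \<open>g\<close>.\<close>

primrec letter_val :: "letter \<Rightarrow> hecke" where
  "letter_val (Pos g) = hecke_gen g"
| "letter_val (Neg g) =
    scale_hecke (gen_norm_inv g) (scale_hecke (gen_trace g) 1 - hecke_gen g)"

lemmas scale_simps =
  scale_mult_left scale_mult_right hecke.scale_right_distrib hecke.scale_left_distrib
  hecke.scale_right_diff_distrib hecke.scale_left_diff_distrib

lemma gen_quadratic:
  "hecke_gen g * hecke_gen g = scale_hecke (gen_trace g) (hecke_gen g) - scale_hecke (gen_norm g) 1"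
  using quadratic_relations[of g]
  by (simp add: gen_trace_def gen_norm_def scale_simps algebra_simps eq_neg_iff_add_eq_0)

lemma letter_val_inv:
  "letter_val l * letter_val (letter_inv l) = 1"
  by (cases l) (simp_all add: scale_simps algebra_simps gen_quadratic)

text \<open>The quadratic relation in a form symmetric in \<open>g\<close> and its inverse. Every
  inference that trades a letter for its inverse rests on it.\<close>

lemma letter_val_eq:
  "\<exists>a b. letter_val l = scale_hecke a 1 + scale_hecke b (letter_val (letter_inv l))"
proof (cases l)
  case (Pos g)
  then have "letter_val l = scale_hecke (gen_trace g) 1
      + scale_hecke (- gen_norm g) (letter_val (letter_inv l))"
    by (simp add: hecke.scale_right_diff_distrib)
  then show ?thesis by blast
next
  case (Neg g)
  then have "letter_val l = scale_hecke (gen_norm_inv g * gen_trace g) 1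
      + scale_hecke (- gen_norm_inv g) (letter_val (letter_inv l))"
    by (simp add: hecke.scale_right_diff_distrib)
  then show ?thesis by blast
qed

definition word_val :: "letter list \<Rightarrow> hecke"
  where "word_val w = prod_list (map letter_val w)"

lemma word_val_simps [simp]:
  "word_val [] = 1"
  "word_val (l # w) = letter_val l * word_val w"
  "word_val (v @ w) = word_val v * word_val w"
  by (simp_all add: word_val_def)

lemma letter_cancel:
  "letter_val l * (letter_val (letter_inv l) * h) = h"
  "letter_val (letter_inv l) * (letter_val l * h) = h"
  using letter_val_inv[of l] letter_val_inv[of "letter_inv l"]
  by (simp_all flip: mult.assoc)

section \<open>The braid group as an amalgamated product\<close>

definition X :: hecke where "X = hecke_gen S * hecke_gen T * hecke_gen U * hecke_gen S"
definition Y :: hecke where "Y = hecke_gen S * hecke_gen T * hecke_gen U"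

lemma Y4: "Y * (Y * (Y * Y)) = z"
  by (simp add: z_def Y_def numeral_eq_Suc mult.assoc)

lemma X_eq:
  "X = hecke_gen T * hecke_gen U * hecke_gen S * hecke_gen T"
  "X = hecke_gen U * hecke_gen S * hecke_gen T * hecke_gen U"
  using braid_relations by (simp_all add: X_def)

text \<open>Spelling the three factors as \<open>stus\<close>, \<open>tust\<close> and
  \<open>ustu\<close> produces the word \<open>(stu)\<^sup>4\<close>.\<close>

lemma X3: "X * (X * X) = z"
proof -
  have "X * (X * X) = (hecke_gen S * hecke_gen T * hecke_gen U * hecke_gen S)
     * ((hecke_gen T * hecke_gen U * hecke_gen S * hecke_gen T)
     * (hecke_gen U * hecke_gen S * hecke_gen T * hecke_gen U))"
    using X_def X_eq by metis
  also have "\<dots> = Y * (Y * (Y * Y))" by (simp add: Y_def mult.assoc)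
  finally show ?thesis by (simp add: Y4)
qed

lemma Ys: "Y * hecke_gen S = X" by (simp add: X_def Y_def)
lemma uY: "hecke_gen U * Y = X" by (simp add: X_eq(2) Y_def mult.assoc)
text \<open>Regroup \<open>(tust) u = t (ustu)\<close>. Thus \<open>t\<close> is a conjugate of
  \<open>u\<close> by \<open>X\<close>; with \<open>Ys\<close> and \<open>uY\<close>, all generators
  are recovered from \<open>X\<close> and \<open>Y\<close>.\<close>

lemma Xu: "X * hecke_gen U = hecke_gen T * X"
proof -
  have "X * hecke_gen U = hecke_gen T * (hecke_gen U * hecke_gen S * hecke_gen T * hecke_gen U)"
    by (simp add: X_eq(1) mult.assoc)
  then show ?thesis by (simp flip: X_eq(2))
qed

section \<open>Powers of the central element \<open>z\<close>\<close>

lemma z_X: "z * X = X * z" using X3 by (metis mult.assoc)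
lemma z_Y: "z * Y = Y * z" using Y4 by (metis mult.assoc)

text \<open>In the ring \<open>hecke\<close> an inverse of \<open>z\<close> has to be exhibited: it
  is the reversed word in the inverse letters.\<close>

definition z_inv :: hecke
  where "z_inv = word_val (concat (replicate 4 [Neg U, Neg T, Neg S]))"

lemma z_z_inv: "z * z_inv = 1" and z_inv_z: "z_inv * z = 1"
proof -
  have z: "z = word_val (concat (replicate 4 [Pos S, Pos T, Pos U]))"
    by (simp add: z_def numeral_eq_Suc mult.assoc)
  show "z * z_inv = 1" "z_inv * z = 1"
    unfolding z z_inv_def using letter_cancel[of "Pos _"] letter_val_inv[of "Pos _"]
      letter_val_inv[of "Neg _"]
    by (simp_all add: numeral_eq_Suc mult.assoc del: letter_val.simps)
qed

lemma z_inv_comm: "z * h = h * z \<Longrightarrow> z_inv * h = h * z_inv"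
  by (metis mult.assoc mult.left_neutral mult.right_neutral z_inv_z z_z_inv)

definition z_pow :: "int \<Rightarrow> hecke"
  where "z_pow k = (if k \<ge> 0 then z ^ nat k else z_inv ^ nat (- k))"

lemma z_pow_0 [simp]: "z_pow 0 = 1" by (simp add: z_pow_def)

lemma z_z_pow: "z * z_pow k = z_pow (k + 1)"
proof (cases "k \<ge> 0")
  case True
  then show ?thesis by (simp add: z_pow_def nat_add_distrib)
next
  case False
  then have "nat (- k) = Suc (nat (- (k + 1)))" by simp
  then have "z * z_pow k = (z * z_inv) * z_inv ^ nat (- (k + 1))"
    using False by (simp add: z_pow_def mult.assoc)
  \<comment> \<open>At \<open>k = - 1\<close> the exponent \<open>k + 1\<close> falls into the other
    branch of \<open>z_pow\<close>.\<close>
  with False show ?thesis by (cases "k = - 1") (simp_all add: z_pow_def z_z_inv)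
qed

lemma z_inv_z_pow: "z_inv * z_pow k = z_pow (k - 1)"
  using z_z_pow[of "k - 1"] z_inv_z by (metis diff_add_cancel mult.assoc mult_1)

lemma z_pow_comm: "z * h = h * z \<Longrightarrow> z_pow k * h = h * z_pow k"
  using power_commuting_commutes[of z h] power_commuting_commutes[of z_inv h] z_inv_comm[of h]
  by (simp add: z_pow_def)

text \<open>
  The braid group is the amalgam of the cyclic groups generated by \<open>X\<close> and \<open>Y\<close> over the
  subgroup generated by \<open>z = X\<^sup>3 = Y\<^sup>4\<close>. So the pairs below, without factors \<open>X\<^sup>3\<close> and \<open>Y\<^sup>4\<close>, are
  normal forms.
\<close>

datatype syllable = SX | SY

type_synonym normal_form = "int \<times> syllable list"

primrec syllable_val :: "syllable \<Rightarrow> hecke" where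
  "syllable_val SX = X"
| "syllable_val SY = Y"

definition nf_val :: "normal_form \<Rightarrow> hecke"
  where "nf_val n = z_pow (fst n) * prod_list (map syllable_val (snd n))"

text \<open>Left multiplication by \<open>X\<close>. A new syllable can complete a forbidden power
  only at the head, so inspecting the head keeps the list normal.\<close>

fun nf_X :: "normal_form \<Rightarrow> normal_form" where
  "nf_X (k, SX # SX # r) = (k + 1, r)"
| "nf_X (k, r) = (k, SX # r)"

fun nf_Y :: "normal_form \<Rightarrow> normal_form" where
  "nf_Y (k, SY # SY # SY # r) = (k + 1, r)"
| "nf_Y (k, r) = (k, SY # r)"

fun nf_z :: "int \<Rightarrow> normal_form \<Rightarrow> normal_form" where
  "nf_z i (k, r) = (i + k, r)"

lemma z_pow_X: "z_pow k * X = X * z_pow k" and z_pow_Y: "z_pow k * Y = Y * z_pow k"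
  by (simp_all add: z_pow_comm z_X z_Y)

lemma z_pow_Suc: "z_pow (k + 1) = z_pow k * z"
  using z_pow_comm[of z k] by (simp flip: z_z_pow)

lemma nf_val_X: "nf_val (nf_X n) = X * nf_val n"
proof (induction n rule: nf_X.induct)
  case (1 k r)
  then show ?case
    by (simp add: nf_val_def z_pow_Suc flip: X3) (metis mult.assoc z_pow_X)
qed (simp_all add: nf_val_def flip: mult.assoc z_pow_X)

lemma nf_val_Y: "nf_val (nf_Y n) = Y * nf_val n"
proof (induction n rule: nf_Y.induct)
  case (1 k r)
  then show ?case
    by (simp add: nf_val_def z_pow_Suc flip: Y4) (metis mult.assoc z_pow_Y)
qed (simp_all add: nf_val_def flip: mult.assoc z_pow_Y)

lemma z_pow_add: "z_pow (i + k) = z_pow i * z_pow k"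
proof (induction i rule: int_induct[of _ 0])
  case base
  show ?case by simp
next
  case (step1 i)
  then show ?case using z_z_pow[of i] z_z_pow[of "i + k"] by (simp add: add_ac flip: mult.assoc)
next
  case (step2 i)
  then show ?case using z_inv_z_pow[of i] z_inv_z_pow[of "i + k"]
    by (simp add: diff_add_eq flip: mult.assoc)
qed

lemma nf_val_z: "nf_val (nf_z i n) = z_pow i * nf_val n"
  by (cases n) (simp add: nf_val_def z_pow_add mult.assoc)

text \<open>Solve \<open>Y s = X\<close>, \<open>u Y = X\<close> and \<open>X u = t X\<close> for
  the generators, with \<open>z\<^sup>-\<^sup>1 X\<^sup>2\<close> and
  \<open>z\<^sup>-\<^sup>1 Y\<^sup>3\<close> as the inverses of \<open>X\<close> and
  \<open>Y\<close>.\<close>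

fun nf_letter :: "letter \<Rightarrow> normal_form \<Rightarrow> normal_form" where
  "nf_letter (Pos S) n = nf_z (- 1) (nf_Y (nf_Y (nf_Y (nf_X n))))"
| "nf_letter (Neg S) n = nf_z (- 1) (nf_X (nf_X (nf_Y n)))"
| "nf_letter (Pos U) n = nf_z (- 1) (nf_X (nf_Y (nf_Y (nf_Y n))))"
| "nf_letter (Neg U) n = nf_z (- 1) (nf_Y (nf_X (nf_X n)))"
| "nf_letter (Pos T) n = nf_z (- 2) (nf_X (nf_X (nf_Y (nf_Y (nf_Y (nf_X (nf_X n)))))))"
| "nf_letter (Neg T) n = nf_z (- 1) (nf_X (nf_Y (nf_X n)))"



section \<open>The letters as products of \<open>X\<close>, \<open>Y\<close> and the inverse of
  \<open>z\<close>\<close>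

lemma z_pow_minus_1: "z_pow (- 1) = z_inv" and z_pow_minus_2: "z_pow (- 2) = z_inv * z_inv"
  by (simp_all add: z_pow_def numeral_eq_Suc)

lemma z_inv_X: "z_inv * X = X * z_inv" and z_inv_Y: "z_inv * Y = Y * z_inv"
  by (simp_all add: z_inv_comm z_X z_Y)

lemma z_inv_cancel: "z_inv * (z * h) = h" "z * (z_inv * h) = h"
  by (simp_all add: z_inv_z z_z_inv flip: mult.assoc)

lemma X3_left: "X * (X * (X * h)) = z * h"
  by (simp flip: X3 add: mult.assoc)

lemma Y4_left: "Y * (Y * (Y * (Y * h))) = z * h"
  by (simp flip: Y4 add: mult.assoc)

lemma letter_val_nf:
  "letter_val (Pos S) = z_inv * (Y * (Y * (Y * X)))"
  "letter_val (Neg S) = z_inv * (X * (X * Y))"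
  "letter_val (Pos U) = z_inv * (X * (Y * (Y * Y)))"
  "letter_val (Neg U) = z_inv * (Y * (X * X))"
  "letter_val (Pos T) = z_inv * (z_inv * (X * (X * (Y * (Y * (Y * (X * X)))))))"
  "letter_val (Neg T) = z_inv * (X * (Y * X))"
proof -
  \<comment> \<open>Since \<open>g\<close> is invertible, a right inverse is the inverse; each
    negative letter needs a single product.\<close>
  have inverse: "letter_val (Neg g) = h" if "hecke_gen g * h = 1" for g h
  proof -
    have "letter_val (Neg g) = letter_val (Neg g) * (hecke_gen g * h)" using that by simp
    also have "\<dots> = h" using letter_cancel(2)[of "Pos g" h] by simp
    finally show ?thesis .
  qed
  note rules = z_inv_cancel X3_left Y4_left X3 Y4 z_inv_z z_z_inv
  have move: "X * (z_inv * h) = z_inv * (X * h)" "Y * (z_inv * h) = z_inv * (Y * h)"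
    "X * (z * h) = z * (X * h)" "Y * (z * h) = z * (Y * h)" "X * z = z * X" "Y * z = z * Y" for h
    using z_inv_X z_inv_Y z_X z_Y by (metis mult.assoc)+
  have S: "hecke_gen S = z_inv * (Y * (Y * (Y * X)))"
    by (simp flip: Ys) (simp add: rules)
  have U: "hecke_gen U = z_inv * (X * (Y * (Y * Y)))"
  proof -
    have "X * (Y * (Y * Y)) = hecke_gen U * z"
      by (simp flip: uY Y4 add: mult.assoc)
    then have "hecke_gen U = X * (Y * (Y * Y)) * z_inv"
      by (simp add: mult.assoc z_z_inv)
    then show ?thesis using z_inv_X z_inv_Y by (metis mult.assoc)
  qed
  \<comment> \<open>Write \<open>z\<close> as \<open>X\<^sup>3\<close> and replace
    \<open>t X\<close> by \<open>X u\<close>.\<close>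
  have "hecke_gen T * z = X * hecke_gen U * (X * X)"
    by (simp flip: X3 add: Xu mult.assoc)
  then have "hecke_gen T = X * hecke_gen U * (X * X) * z_inv"
    by (metis mult.assoc mult.right_neutral z_z_inv)
  also have "\<dots> = z_inv * (z_inv * (X * (X * (Y * (Y * (Y * (X * X)))))))"
    using z_inv_X z_inv_Y by (simp add: U move mult.assoc flip: z_inv_X)
  finally have T: "hecke_gen T = \<dots>" .
  show "letter_val (Pos S) = z_inv * (Y * (Y * (Y * X)))"
    "letter_val (Pos U) = z_inv * (X * (Y * (Y * Y)))"
    "letter_val (Pos T) = z_inv * (z_inv * (X * (X * (Y * (Y * (Y * (X * X)))))))"
    using S T U by simp_all
  show "letter_val (Neg S) = z_inv * (X * (X * Y))"
    by (rule inverse) (simp add: S mult.assoc move rules)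
  show "letter_val (Neg U) = z_inv * (Y * (X * X))"
    by (rule inverse) (simp add: U mult.assoc move rules)
  show "letter_val (Neg T) = z_inv * (X * (Y * X))"
    by (rule inverse) (simp add: T mult.assoc move rules)
qed

lemma nf_val_letter: "nf_val (nf_letter l n) = letter_val l * nf_val n"
  by (induction l n rule: nf_letter.induct)
    (simp_all only: nf_letter.simps nf_val_X nf_val_Y nf_val_z z_pow_minus_1 z_pow_minus_2
      letter_val_nf mult.assoc)

text \<open>This is the centrality of \<open>z\<close>: it commutes with \<open>X\<close> and
  \<open>Y\<close>, and each letter is a product of \<open>X\<close>, \<open>Y\<close> and
  \<open>z_inv\<close>.\<close>

lemma z_pow_letter: "z_pow k * letter_val l = letter_val l * z_pow k"
proof -
  have z_inv: "z_pow k * z_inv = z_inv * z_pow k"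
    by (simp add: z_pow_comm z_z_inv z_inv_z)
  have move: "z_pow k * (X * h) = X * (z_pow k * h)" "z_pow k * (Y * h) = Y * (z_pow k * h)"
    "z_pow k * (z_inv * h) = z_inv * (z_pow k * h)" for h
    by (simp_all add: z_pow_X z_pow_Y z_inv flip: mult.assoc)
  show ?thesis
    by (cases l; cases "letter_gen l")
      (simp_all only: letter_gen.simps letter_val_nf mult.assoc move z_pow_X z_pow_Y)
qed

lemma z_pow_word: "z_pow k * word_val w = word_val w * z_pow k"
  by (induction w) (simp_all add: mult.assoc, metis mult.assoc z_pow_letter)

text \<open>A pair \<open>(k, w)\<close> stands for the braid \<open>z\<^sup>k w\<close>.\<close>

type_synonym braid = "int \<times> letter list"

definition braid_val :: "braid \<Rightarrow> hecke"
  where "braid_val v = z_pow (fst v) * word_val (snd v)"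

definition nf_braid :: "braid \<Rightarrow> normal_form"
  where "nf_braid v = foldr nf_letter (snd v) (fst v, [])"

lemma nf_val_braid: "nf_val (nf_braid v) = braid_val v"
proof -
  have "nf_val (foldr nf_letter w n) = word_val w * nf_val n" for w n
    by (induction w) (simp_all add: nf_val_letter mult.assoc)
  then show ?thesis by (simp add: nf_braid_def braid_val_def z_pow_word) (simp add: nf_val_def)
qed

text \<open>Through this, identities of braids in the certificates are checked by evaluating normal
  forms.\<close>

lemma braid_val_eqI: "nf_braid v = nf_braid w \<Longrightarrow> braid_val v = braid_val w"
  by (metis nf_val_braid)


section \<open>Spans of braids\<close>

lemma subspace_left: "hecke.subspace V \<Longrightarrow> hecke.subspace {x. h * x \<in> V}"
  by (rule hecke.subspaceI)
    (auto simp: distrib_left scale_mult_right hecke.subspace_0 hecke.subspace_add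
      hecke.subspace_scale)

lemma subspace_right: "hecke.subspace V \<Longrightarrow> hecke.subspace {x. x * h \<in> V}"
  by (rule hecke.subspaceI)
    (auto simp: distrib_right scale_mult_left hecke.subspace_0 hecke.subspace_add
      hecke.subspace_scale)

text \<open>The product is bilinear, so linearity is used in one factor at a time, first in
  \<open>y\<close>, then in \<open>x\<close>.\<close>

lemma span_prod_span:
  "hecke.span A \<odot> hecke.span B = hecke.span {a * b | a b. a \<in> A \<and> b \<in> B}" (is "_ = ?V")
proof
  have right: "a * y \<in> ?V" if "a \<in> A" "y \<in> hecke.span B" for a y
  proof -
    have "hecke.span B \<subseteq> {y. a * y \<in> ?V}"
      using \<open>a \<in> A\<close>
      by (intro hecke.span_minimal subspace_left hecke.subspace_span) (blast intro: hecke.span_base)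
    with that(2) show ?thesis by blast
  qed
  have "x * y \<in> ?V" if "x \<in> hecke.span A" "y \<in> hecke.span B" for x y
  proof -
    have "hecke.span A \<subseteq> {x. x * y \<in> ?V}"
      using right[OF _ that(2)]
      by (intro hecke.span_minimal subspace_right hecke.subspace_span) blast
    with that(1) show ?thesis by blast
  qed
  then show "hecke.span A \<odot> hecke.span B \<subseteq> ?V"
    unfolding span_prod_def by (intro hecke.span_minimal hecke.subspace_span) auto
  show "?V \<subseteq> hecke.span A \<odot> hecke.span B"
    unfolding span_prod_def by (intro hecke.span_mono) (auto intro: hecke.span_base)
qed

lemma span_prod_span_left: "hecke.span A \<odot> B = A \<odot> B"
  if "hecke.span B = B"
  using span_prod_span[of A B] that by (simp add: span_prod_def)

section \<open>The subalgebras of the generators and their products\<close>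

primrec gen_alg :: "gen \<Rightarrow> hecke set" where
  "gen_alg S = u1"
| "gen_alg T = u2"
| "gen_alg U = u3"

lemma gen_alg_eq: "gen_alg g = subalgebra hull {hecke_gen g}"
  by (cases g) (simp_all add: u1_def u2_def u3_def)

lemma gen_alg_subalgebra: "subalgebra (gen_alg g)"
  unfolding gen_alg_eq by (rule hull_in) (auto simp: subalgebra_def hecke.subspace_Inter)

text \<open>The quadratic relation puts \<open>g\<^sup>2\<close> into the span of \<open>1\<close>
  and \<open>g\<close>, so this span is already closed under multiplication.\<close>

lemma gen_alg_span: "gen_alg g = hecke.span {1, hecke_gen g}"
proof
  let ?V = "hecke.span {1, hecke_gen g}"
  have in_V: "1 \<in> ?V" "hecke_gen g \<in> ?V" "hecke_gen g * hecke_gen g \<in> ?V"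
    by (simp_all add: gen_quadratic hecke.span_base hecke.span_diff hecke.span_scale)
  have "?V \<odot> ?V \<subseteq> ?V"
    unfolding span_prod_span using in_V
    by (intro hecke.span_minimal hecke.subspace_span) auto
  then have "x * y \<in> ?V" if "x \<in> ?V" "y \<in> ?V" for x y
    using that unfolding span_prod_def by (blast intro: hecke.span_base)
  then have "subalgebra ?V"
    using in_V(1) by (simp add: subalgebra_def hecke.subspace_span)
  then show "gen_alg g \<subseteq> ?V"
    unfolding gen_alg_eq using in_V(2) by (intro hull_minimal) auto
  have "hecke_gen g \<in> gen_alg g" unfolding gen_alg_eq by (rule hull_inc) simp
  then show "?V \<subseteq> gen_alg g"
    using gen_alg_subalgebra[of g] by (intro hecke.span_minimal) (auto simp: subalgebra_def)
qed

lemma letter_val_in: "letter_val l \<in> gen_alg (letter_gen l)"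
  unfolding gen_alg_span
  by (cases l) (simp_all add: hecke.span_base hecke.span_diff hecke.span_scale)

lemma word_val_in_gen_alg:
  "(\<And>l. l \<in> set w \<Longrightarrow> letter_gen l = g) \<Longrightarrow> word_val w \<in> gen_alg g"
proof (induction w)
  case Nil
  then show ?case using gen_alg_subalgebra[of g] by (simp add: subalgebra_def)
next
  case (Cons l w)
  then show ?case
    using gen_alg_subalgebra[of g] letter_val_in[of l] by (auto simp: subalgebra_def)
qed

lemma in_span_prod: "x \<in> A \<Longrightarrow> y \<in> B \<Longrightarrow> x * y \<in> A \<odot> B"
  unfolding span_prod_def by (auto intro: hecke.span_base)

text \<open>Nested to the left like the infix \<open>\<odot>\<close>, so that it unfolds to the
  summands of the theorem.\<close>

definition gen_prod :: "nat \<Rightarrow> gen list \<Rightarrow> hecke set"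
  where "gen_prod k p = foldl (\<odot>) {z ^ k} (map gen_alg p)"

text \<open>Each entry of the pattern consumes the longest, possibly empty, run of its own letters.
  An accepted word visibly lies in the product of the corresponding subalgebras.\<close>

fun blocks :: "gen list \<Rightarrow> letter list \<Rightarrow> bool" where
  "blocks [] w \<longleftrightarrow> w = []"
| "blocks (g # p) w \<longleftrightarrow> blocks p (dropWhile (\<lambda>l. letter_gen l = g) w)"

lemma blocks_in_gen_prod:
  assumes "blocks p w"
  shows "z ^ k * word_val w \<in> gen_prod k p"
proof -
  \<comment> \<open>\<open>foldl\<close> collects the product in its accumulator, so the induction
    needs an arbitrary first factor \<open>A\<close>.\<close>
  have "x * word_val w \<in> foldl (\<odot>) A (map gen_alg p)" if "x \<in> A" for x A
    using assms that
  proof (induction p arbitrary: w x A)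
    case Nil
    then show ?case by simp
  next
    case (Cons g p)
    let ?v = "takeWhile (\<lambda>l. letter_gen l = g) w" and ?w = "dropWhile (\<lambda>l. letter_gen l = g) w"
    have "x * word_val ?v \<in> A \<odot> gen_alg g"
      using Cons.prems(2) by (intro in_span_prod word_val_in_gen_alg) (auto dest: set_takeWhileD)
    with Cons have "x * word_val ?v * word_val ?w \<in> foldl (\<odot>) (A \<odot> gen_alg g) (map gen_alg p)"
      by auto
    moreover have "word_val w = word_val ?v * word_val ?w"
      by (simp flip: word_val_simps)
    ultimately show ?case by (simp add: mult.assoc)
  qed
  then show ?thesis by (simp add: gen_prod_def)
qed

text \<open>Each factor is spanned by \<open>1\<close> and \<open>g\<close>; choosing one of the two
  in every factor amounts to choosing a subsequence of \<open>p\<close>.\<close>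

lemma gen_prod_span:
  assumes "p \<noteq> []"
  shows "gen_prod k p = hecke.span {z ^ k * word_val (map Pos w) | w. w \<in> set (subseqs p)}"
proof -
  have *: "foldl (\<odot>) (hecke.span A) (map gen_alg p)
      = hecke.span {a * word_val (map Pos w) | a w. a \<in> A \<and> w \<in> set (subseqs p)}" for A p
  proof (induction p arbitrary: A)
    case Nil
    then show ?case by simp
  next
    case (Cons g p)
    let ?A = "{a * b | a b. a \<in> A \<and> b \<in> {1, hecke_gen g}}"
    have "{a * word_val (map Pos w) | a w. a \<in> ?A \<and> w \<in> set (subseqs p)}
        = {a * word_val (map Pos w) | a w. a \<in> A \<and> w \<in> set (subseqs (g # p))}" (is "?B = ?C")
    proof
      show "?B \<subseteq> ?C"
      proof
        fix x assume "x \<in> ?B"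
        then obtain a b w where x: "x = a * b * word_val (map Pos w)" "a \<in> A"
          and b: "b \<in> {1, hecke_gen g}" and w: "w \<in> set (subseqs p)" by blast
        from b consider "b = 1" | "b = hecke_gen g" by blast
        then have "\<exists>v\<in>set (subseqs (g # p)). x = a * word_val (map Pos v)"
        proof cases
          case 1
          then show ?thesis using w x(1) by (auto simp: Let_def)
        next
          case 2
          then have "x = a * word_val (map Pos (g # w))" using x(1) by (simp add: mult.assoc)
          moreover have "g # w \<in> set (subseqs (g # p))" using w by (simp add: Let_def)
          ultimately show ?thesis by blast
        qed
        with x(2) show "x \<in> ?C" by blast
      qed
      show "?C \<subseteq> ?B"
      proof
        fix x assume "x \<in> ?C"
        then obtain a w where x: "x = a * word_val (map Pos w)" "a \<in> A"
          and "w \<in> set (subseqs (g # p))" by blast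
        then consider v where "w = g # v" "v \<in> set (subseqs p)" | "w \<in> set (subseqs p)"
          by (auto simp: Let_def)
        then show "x \<in> ?B"
        proof cases
          case 1
          then have "x = (a * hecke_gen g) * word_val (map Pos v)" by (simp add: x mult.assoc)
          with x 1 show ?thesis by blast
        next
          case 2
          then have "x = (a * 1) * word_val (map Pos w)" by (simp add: x)
          with x 2 show ?thesis by blast
        qed
      qed
    qed
    with Cons show ?case by (simp add: gen_alg_span span_prod_span)
  qed
  \<comment> \<open>The first subalgebra is a span, so \<open>{z ^ k}\<close> in front of it may be
    replaced by its span. For an empty \<open>p\<close> the left side would be the bare
    singleton.\<close>
  obtain g q where p: "p = g # q" using assms by (cases p) auto
  have "{z ^ k} \<odot> gen_alg g = hecke.span {z ^ k} \<odot> gen_alg g"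
    by (rule span_prod_span_left[symmetric]) (simp add: gen_alg_span)
  then have "gen_prod k p = foldl (\<odot>) (hecke.span {z ^ k}) (map gen_alg p)"
    by (simp add: gen_prod_def p)
  then show ?thesis by (simp add: *)
qed

section \<open>The submodule \<open>V\<close> and a finite spanning set\<close>

definition patterns :: "gen list list"
  where "patterns = [[S, U, S, T], [S, T, U, T], [T, U, S, T], [T, S, U, T], [U, T, S, T]]"

text \<open>This is \<open>V\<close>. All five patterns end in \<open>T\<close>, which gives the
  stability under right multiplication by \<open>t\<close>.\<close>

definition pattern_span :: "hecke set"
  where "pattern_span = hecke.span (\<Union>k\<in>{0, 1}. \<Union>p\<in>set patterns. gen_prod k p)"

lemma span_prod_subspace: "hecke.span (A \<odot> B) = A \<odot> B"
  by (simp add: span_prod_def)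

text \<open>The span of a union is the sum of the spans, and each product of subalgebras is its own
  span.\<close>

lemma pattern_span_eq:
  "pattern_span = (\<Sum>k\<in>{0..1::nat}.
        {z ^ k} \<odot> u1 \<odot> u3 \<odot> u1 \<odot> u2
      + {z ^ k} \<odot> u1 \<odot> u2 \<odot> u3 \<odot> u2
      + {z ^ k} \<odot> u2 \<odot> u3 \<odot> u1 \<odot> u2
      + {z ^ k} \<odot> u2 \<odot> u1 \<odot> u3 \<odot> u2
      + {z ^ k} \<odot> u3 \<odot> u2 \<odot> u1 \<odot> u2)"
proof -
  have plus: "hecke.span (A \<union> B) = hecke.span A + hecke.span B" for A B
    by (auto simp: hecke.span_Un set_plus_def)
  have "{0..1::nat} = {0, 1}" by auto
  then show ?thesis
    by (simp add: pattern_span_def patterns_def gen_prod_def plus span_prod_subspace add.assoc)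
qed

lemma subspace_pattern_span: "hecke.subspace pattern_span"
  by (simp add: pattern_span_def)

text \<open>Left stability of \<open>V\<close> is tested on these finitely many braids.\<close>

lemma pattern_span_basis:
  "pattern_span = hecke.span {braid_val (k, map Pos w) | k w.
     k \<in> {0, 1} \<and> w \<in> (\<Union>p\<in>set patterns. set (subseqs p))}"
proof -
  have *: "hecke.span (\<Union>i\<in>I. hecke.span (f i)) = hecke.span (\<Union>i\<in>I. f i)"
    for f :: "'i \<Rightarrow> hecke set" and I
    by (intro equalityI hecke.span_minimal hecke.subspace_span hecke.span_mono)
      (auto intro: hecke.span_base dest: hecke.span_mono[THEN subsetD, rotated])
  have "pattern_span = hecke.span (\<Union>(k, p)\<in>{0, 1} \<times> set patterns.
      hecke.span {z ^ k * word_val (map Pos w) | w. w \<in> set (subseqs p)})"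
    unfolding pattern_span_def
    by (intro arg_cong[where f = hecke.span])
      (force simp: patterns_def gen_prod_span)
  also have "\<dots> = hecke.span (\<Union>(k, p)\<in>{0, 1} \<times> set patterns.
      {z ^ k * word_val (map Pos w) | w. w \<in> set (subseqs p)})"
    using *[of "\<lambda>(k, p). {z ^ k * word_val (map Pos w) | w. w \<in> set (subseqs p)}"
        "{0, 1} \<times> set patterns"]
    by (simp add: case_prod_unfold)
  also have "(\<Union>(k, p)\<in>{0, 1} \<times> set patterns.
      {z ^ k * word_val (map Pos w) | w. w \<in> set (subseqs p)})
    = {braid_val (k, map Pos w) | k w. k \<in> {0, 1} \<and> w \<in> (\<Union>p\<in>set patterns. set (subseqs p))}"
    by (auto simp: braid_val_def z_pow_def) force+
  finally show ?thesis .
qed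


section \<open>Certificates for membership\<close>

abbreviation in_span :: "braid \<Rightarrow> bool"
  where "in_span v \<equiv> braid_val v \<in> pattern_span"

text \<open>\<open>L\<close> holds the generators already shown to preserve \<open>V\<close>; it
  grows from stage to stage of the certificate.\<close>

definition left_stable :: "gen list \<Rightarrow> bool"
  where "left_stable L \<longleftrightarrow> (\<forall>g\<in>set L. \<forall>x\<in>pattern_span. hecke_gen g * x \<in> pattern_span)"

text \<open>The inverse of \<open>g\<close> is a linear combination of \<open>1\<close> and
  \<open>g\<close>, so it preserves \<open>V\<close> as well.\<close>

lemma letter_stable:
  assumes "left_stable L" "letter_gen l \<in> set L" "x \<in> pattern_span"
  shows "letter_val l * x \<in> pattern_span"
  using assms subspace_pattern_span unfolding left_stable_def
  by (cases l)
    (auto simp: scale_mult_left left_diff_distrib intro!: hecke.subspace_scale hecke.subspace_diff)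

text \<open>The last factor is closed under multiplication and absorbs \<open>c\<close>.\<close>

lemma gen_prod_right:
  assumes "x \<in> gen_prod k (p @ [g])" "c \<in> gen_alg g"
  shows "x * c \<in> gen_prod k (p @ [g])"
proof -
  let ?A = "foldl (\<odot>) {z ^ k} (map gen_alg p)"
  have V: "gen_prod k (p @ [g]) = ?A \<odot> gen_alg g" by (simp add: gen_prod_def)
  have "a * b * c \<in> ?A \<odot> gen_alg g" if "a \<in> ?A" "b \<in> gen_alg g" for a b
    using that assms(2) gen_alg_subalgebra[of g]
    by (auto simp: mult.assoc subalgebra_def intro: in_span_prod)
  then have "hecke.span {a * b | a b. a \<in> ?A \<and> b \<in> gen_alg g} \<subseteq> {x. x * c \<in> ?A \<odot> gen_alg g}"
    by (intro hecke.span_minimal subspace_right) (auto simp: span_prod_def)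
  with assms(1) show ?thesis by (auto simp: V span_prod_def)
qed

lemma pattern_span_right:
  assumes "x \<in> pattern_span" "letter_gen l = T"
  shows "x * letter_val l \<in> pattern_span"
proof -
  have "y * letter_val l \<in> gen_prod k p" if "y \<in> gen_prod k p" "p \<in> set patterns" for y k p
  proof -
    from that(2) obtain q where "p = q @ [T]" by (auto simp: patterns_def)
    with that(1) letter_val_in[of l] assms(2) show ?thesis by (simp add: gen_prod_right)
  qed
  then have "pattern_span \<subseteq> {y. y * letter_val l \<in> pattern_span}"
    unfolding pattern_span_def
    by (intro hecke.span_minimal subspace_right hecke.subspace_span)
      (blast intro: hecke.span_base)
  with assms(1) show ?thesis by blast
qed

text \<open>The letters removed, like their inverses, preserve \<open>V\<close> from their side.
  Membership is therefore unchanged, and one derived braid covers many words.\<close>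

definition strip :: "gen list \<Rightarrow> letter list \<Rightarrow> letter list"
  where "strip L w =
    rev (dropWhile (\<lambda>l. letter_gen l = T) (rev (dropWhile (\<lambda>l. letter_gen l \<in> set L) w)))"

lemma in_span_left:
  assumes "left_stable L" "letter_gen l \<in> set L"
  shows "in_span (k, l # w) \<longleftrightarrow> in_span (k, w)"
proof -
  have "braid_val (k, l # w) = letter_val l * braid_val (k, w)"
    by (simp add: braid_val_def flip: mult.assoc) (simp add: z_pow_letter)
  then show ?thesis
    using letter_stable[OF assms, of "braid_val (k, w)"]
      letter_stable[OF assms(1), of "letter_inv l" "braid_val (k, l # w)"] assms(2)
    by (auto simp: letter_cancel)
qed

lemma in_span_right:
  assumes "letter_gen l = T"
  shows "in_span (k, w @ [l]) \<longleftrightarrow> in_span (k, w)"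
proof -
  have "braid_val (k, w @ [l]) = braid_val (k, w) * letter_val l"
    by (simp add: braid_val_def mult.assoc)
  moreover from this have "braid_val (k, w @ [l]) * letter_val (letter_inv l) = braid_val (k, w)"
    by (simp add: mult.assoc letter_val_inv)
  ultimately show ?thesis using pattern_span_right assms by (metis letter_gen_inv)
qed

lemma in_span_strip:
  assumes "left_stable L"
  shows "in_span (k, strip L w) \<longleftrightarrow> in_span (k, w)"
proof -
  have left: "in_span (k, dropWhile (\<lambda>l. letter_gen l \<in> set L) w) \<longleftrightarrow> in_span (k, w)" for w
    by (induction w) (simp_all add: in_span_left[OF assms])
  have "in_span (k, rev (dropWhile (\<lambda>l. letter_gen l = T) w)) \<longleftrightarrow> in_span (k, rev w)" for w
    by (induction w) (simp_all add: in_span_right)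
  from this[of "rev (dropWhile (\<lambda>l. letter_gen l \<in> set L) w)"] left show ?thesis
    by (simp add: strip_def)
qed

text \<open>Words are compared letter by letter only; identities of braids enter through the normal
  forms in \<open>derives\<close>. The exponents 0 and 1 are those in the sum defining
  \<open>V\<close>.\<close>

fun known :: "gen list \<Rightarrow> braid list \<Rightarrow> braid \<Rightarrow> bool" where
  "known L vs (k, w) \<longleftrightarrow>
    (k = 0 \<or> k = 1) \<and> list_ex (\<lambda>p. blocks p (strip L w)) patterns
    \<or> list_ex (\<lambda>(k', w'). k = k' \<and> strip L w = strip L w') vs"

lemma known_sound:
  assumes "left_stable L" "\<forall>v\<in>set vs. in_span v" "known L vs v"
  shows "in_span v"
proof -
  obtain k w where v: "v = (k, w)" by (cases v)
  have "in_span (k, strip L w)" if "k = 0 \<or> k = 1" "p \<in> set patterns" "blocks p (strip L w)" for p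
  proof -
    from that(1) have "z_pow k = z ^ nat k" "nat k \<in> {0, 1}" by (auto simp: z_pow_def)
    with blocks_in_gen_prod[OF that(3), of "nat k"] that(2) show ?thesis
      unfolding pattern_span_def braid_val_def by (auto intro!: hecke.span_base)
  qed
  moreover have "in_span (k, strip L w)" if "(k, w') \<in> set vs" "strip L w = strip L w'" for w'
    using that assms by (auto simp: in_span_strip)
  ultimately have "in_span (k, strip L w)"
    using assms(3) by (auto simp: v list_ex_iff)
  then show ?thesis using assms(1) by (simp add: v in_span_strip)
qed

text \<open>
  \<open>Braid v w\<close> derives \<open>v\<close> from an equal braid \<open>w\<close>, and \<open>Quadratic k p l q v w\<close> derives
  \<open>z\<^sup>k p l q\<close> from braids equal to \<open>z\<^sup>k p l\<^sup>-\<^sup>1 q\<close> and \<open>z\<^sup>k p q\<close>.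
\<close>

datatype step = Braid braid braid | Quadratic int "letter list" letter "letter list" braid braid

text \<open>The certificate supplies spellings that \<open>known\<close> recognizes, and normal
  forms tie them to the braids that the inference requires.\<close>

fun derives :: "gen list \<Rightarrow> braid list \<Rightarrow> step list \<Rightarrow> braid list option" where
  "derives L vs [] = Some vs"
| "derives L vs (Braid v w # steps) =
    (if known L vs w \<and> nf_braid v = nf_braid w then derives L (v # vs) steps else None)"
| "derives L vs (Quadratic k p l q v w # steps) =
    (if known L vs v \<and> known L vs w \<and> nf_braid v = nf_braid (k, p @ letter_inv l # q)
        \<and> nf_braid w = nf_braid (k, p @ q)
     then derives L ((k, p @ l # q) # vs) steps else None)"

lemma quadratic_in_span:
  assumes "in_span (k, p @ letter_inv l # q)" "in_span (k, p @ q)"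
  shows "in_span (k, p @ l # q)"
proof -
  obtain a b where "letter_val l = scale_hecke a 1 + scale_hecke b (letter_val (letter_inv l))"
    using letter_val_eq by blast
  then have "braid_val (k, p @ l # q) = scale_hecke a (braid_val (k, p @ q))
      + scale_hecke b (braid_val (k, p @ letter_inv l # q))"
    by (simp add: braid_val_def scale_mult_left scale_mult_right distrib_left distrib_right mult.assoc)
  then show ?thesis
    using assms subspace_pattern_span by (simp add: hecke.subspace_add hecke.subspace_scale)
qed

lemma derives_sound:
  assumes "left_stable L" "\<forall>v\<in>set vs. in_span v" "derives L vs steps = Some ws"
  shows "\<forall>v\<in>set ws. in_span v"
  using assms(2,3)
proof (induction steps arbitrary: vs)
  case Nil
  then show ?case by simp
next
  case (Cons step steps)
  note known = known_sound[OF assms(1) Cons.prems(1)]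
  show ?case
  proof (cases step)
    case (Braid v w)
    then have "known L vs w" "nf_braid v = nf_braid w" "derives L (v # vs) steps = Some ws"
      using Cons.prems(2) by (auto split: if_splits)
    moreover from this have "\<forall>v\<in>set (v # vs). in_span v"
      using Cons.prems(1) known[of w] braid_val_eqI[of v w] by simp
    ultimately show ?thesis using Cons.IH by blast
  next
    case (Quadratic k p l q v w)
    then have "known L vs v" "known L vs w" "nf_braid v = nf_braid (k, p @ letter_inv l # q)"
      "nf_braid w = nf_braid (k, p @ q)" "derives L ((k, p @ l # q) # vs) steps = Some ws"
      using Cons.prems(2) by (auto split: if_splits)
    then have "in_span (k, p @ l # q)"
      using known[of v] known[of w] quadratic_in_span[of k p l q] braid_val_eqI by metis
    then have "\<forall>v\<in>set ((k, p @ l # q) # vs). in_span v"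
      using Cons.prems(1) by simp
    then show ?thesis by (rule Cons.IH) fact
  qed
qed

definition generators_known :: "gen list \<Rightarrow> braid list \<Rightarrow> gen \<Rightarrow> bool"
  where "generators_known L vs g \<longleftrightarrow>
    (\<forall>k\<in>{0, 1}. \<forall>p\<in>set patterns. \<forall>w\<in>set (subseqs p). known L vs (k, Pos g # map Pos w))"

text \<open>Since \<open>z\<close> is central and multiplication is linear, the finite check on
  spanning braids extends to all of \<open>V\<close>.\<close>

lemma stable_Cons:
  assumes "left_stable L" "\<forall>v\<in>set vs. in_span v" "generators_known L vs g"
  shows "left_stable (g # L)"
proof -
  have "hecke_gen g * braid_val (k, map Pos w) \<in> pattern_span"
    if "k \<in> {0, 1}" "p \<in> set patterns" "w \<in> set (subseqs p)" for k p w
  proof -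
    have "in_span (k, Pos g # map Pos w)"
      using assms(3) that known_sound[OF assms(1,2)] unfolding generators_known_def by blast
    moreover have "braid_val (k, Pos g # map Pos w) = hecke_gen g * braid_val (k, map Pos w)"
      using z_pow_letter[of k "Pos g"] by (simp add: braid_val_def flip: mult.assoc)
    ultimately show ?thesis by simp
  qed
  then have "pattern_span \<subseteq> {x. hecke_gen g * x \<in> pattern_span}"
    by (subst (1) pattern_span_basis)
      (intro hecke.span_minimal subspace_left subspace_pattern_span, blast)
  with assms(1) show ?thesis by (auto simp: left_stable_def)
qed

text \<open>Every element of the quotient is a linear combination of words, and each word arises
  from \<open>1\<close> by left multiplication by generators.\<close>

lemma pattern_span_eq_UNIV:
  assumes "left_stable L" "set L = UNIV"
  shows "pattern_span = UNIV"
proof -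
  have scaled_one: "scale_hecke r 1 \<in> pattern_span" for r
  proof -
    \<comment> \<open>The empty word matches a pattern with all blocks empty.\<close>
    have "in_span (0, [])"
      using known_sound[of L "[]" "(0, [])"] assms(1) by (simp add: strip_def patterns_def)
    then show ?thesis by (simp add: braid_val_def subspace_pattern_span hecke.subspace_scale)
  qed
  have left: "hecke_gen g * x \<in> pattern_span" if "x \<in> pattern_span" for g x
    using assms that by (auto simp: left_stable_def)
  define val :: "free_alg \<Rightarrow> hecke" where "val = abs_hecke"
  have "val x \<in> pattern_span" for x
  proof (induction x rule: poly_mapping_single_induct)
    case zero
    have "val 0 = 0" by (simp add: val_def zero_hecke.abs_eq)
    then show ?case by (simp add: subspace_pattern_span hecke.subspace_0)
  next
    case (add k v f)
    have "val (Poly_Mapping.single (Word w) v) \<in> pattern_span" for w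
    proof (induction w)
      case Nil
      have "val (Poly_Mapping.single (Word []) v) = scale_hecke v 1"
        by (simp add: val_def one_hecke.abs_eq scale_hecke.abs_eq free_const_def
            flip: zero_word_def)
      then show ?case using scaled_one by simp
    next
      case (Cons g w)
      have "val (Poly_Mapping.single (Word (g # w)) v) = hecke_gen g * val (Poly_Mapping.single (Word w) v)"
        by (simp add: val_def hecke_gen_def times_hecke.abs_eq free_gen_def mult_single plus_word_def)
      then show ?case using left[OF Cons] by simp
    qed
    then have "val (Poly_Mapping.single k v) \<in> pattern_span" by (metis word.collapse)
    moreover have "val (Poly_Mapping.single k v + f) = val (Poly_Mapping.single k v) + val f"
      by (simp add: val_def plus_hecke.abs_eq)
    ultimately show ?case using add by (simp add: subspace_pattern_span hecke.subspace_add)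
  qed
  then show ?thesis unfolding val_def by (metis UNIV_eq_I Quotient_abs_rep[OF Quotient_hecke])
qed


text \<open>Each stage establishes one generator; the next may strip its letters on the left and
  reuse all braids derived so far.\<close>

fun certifies :: "gen list \<Rightarrow> braid list \<Rightarrow> (gen \<times> step list) list \<Rightarrow> bool" where
  "certifies L vs [] \<longleftrightarrow> S \<in> set L \<and> T \<in> set L \<and> U \<in> set L"
| "certifies L vs ((g, steps) # stages) \<longleftrightarrow>
    (case derives L vs steps of
      None \<Rightarrow> False
    | Some ws \<Rightarrow> generators_known L ws g \<and> certifies (g # L) ws stages)"

lemma certifies_sound:
  "left_stable L \<Longrightarrow> \<forall>v\<in>set vs. in_span v \<Longrightarrow> certifies L vs stages \<Longrightarrow> pattern_span = UNIV"
proof (induction L vs stages rule: certifies.induct)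
  case (1 L vs)
  then have "g \<in> set L" for g by (cases g) simp_all
  with 1 show ?case by (intro pattern_span_eq_UNIV) auto
next
  case (2 L vs g steps stages)
  from 2(4) obtain ws where ws: "derives L vs steps = Some ws" "generators_known L ws g"
    "certifies (g # L) ws stages"
    by (auto split: option.splits)
  have "\<forall>v\<in>set ws. in_span v" by (rule derives_sound[OF 2(2,3) ws(1)])
  with 2 ws show ?case using stable_Cons by blast
qed

section \<open>The inferences for \<open>s\<close>, \<open>t\<close> and \<open>u\<close>\<close>

context
begin

private abbreviation (input) "s \<equiv> Pos S"
private abbreviation (input) "t \<equiv> Pos T"
private abbreviation (input) "u \<equiv> Pos U"
private abbreviation (input) "s' \<equiv> Neg S"
private abbreviation (input) "t' \<equiv> Neg T"
private abbreviation (input) "u' \<equiv> Neg U"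

text \<open>Cancelling pairs are deliberate: \<open>s t u' u s\<close> is the braid
  \<open>s t s\<close>, spelled so that the quadratic inference applies at the inserted
  \<open>u'\<close>. The closing \<open>Braid\<close> steps provide products \<open>s w\<close> in
  the spelling that \<open>generators_known\<close> looks up.\<close>

definition "steps_s =
  [Quadratic 0 [u'] s' [s, t, u, t, u, s]
     (1, [u', u', t', s', t', t']) (1, [t', s', u', t', t', t', t']),
   Quadratic 0 [s, t] u' [u, s]
     (0, [u', s', s, t, u, t, u, s, t]) (0, [t, u, s, t]),
   Quadratic 0 [s, t] s' [t']
     (0, [s, t, u', u, s, t']) (0, [s]),
   Quadratic 0 [s, t, s'] u []
     (0, [u', t', s, t]) (0, [s, t, s', t', t]),
   Quadratic 0 [s, t] s [u, t, t]
     (0, [s, t, s', u, t, t]) (0, [s, t, u, t, t]),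
   Quadratic 0 [] s [s, t, s', u']
     (0, [t, s', u']) (0, [u', t', s, t]),
   Quadratic 0 [s, u'] t [s, t]
     (0, [s, s, t, s', u']) (0, [s, u', s, t]),
   Quadratic 0 [s] u [t, s]
     (0, [s, u', t, s, t, t']) (0, [s, t, u', u, s]),
   Quadratic 0 [] s [s, t, u, u, s, t']
     (0, [t, u, u, s, t']) (0, [u', s', s, t, u, t, u, s]),
   Quadratic 1 [u', t', s'] t [u', t']
     (0, [s, s, t, u, u, s, t', t]) (1, [t', s', u', t', t']),
   Quadratic 1 [s, t', s'] u [u', t', t']
     (1, [u', t', s', t, u', t', t']) (1, [u', t', s', t']),
   Quadratic 1 [s] t [s', t']
     (1, [s, t', s', u, u', t', t', t]) (1, [t']),
   Quadratic 1 [s, t, s'] u [t']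
     (1, [u', t', s]) (1, [s, t, s', t']),
   Quadratic 1 [s, t] s [u]
     (1, [s, t, s', u, t', t]) (1, [s, t, u]),
   Quadratic 1 [s, t] s [t]
     (1, [s, t, s', t', t, t]) (1, [s, t, t]),
   Quadratic 1 [] s [s, t, s', u', t]
     (1, [t, s', u', t]) (1, [u', t', s, t, t]),
   Quadratic 1 [s, u'] t [s]
     (1, [s, s, t, s', u', t, t', t']) (1, [s, u', s]),
   Quadratic 1 [s] u [t, s, t']
     (1, [s, u', t, s, t']) (1, [s, t, s, t, t', t']),
   Braid (0, [s, t, s]) (0, [s, t, u', u, s]),
   Braid (0, [s, t, u, s]) (0, [t, u, s, t]),
   Braid (1, [s, t, u, s]) (1, [t, u, s, t])]"

text \<open>Words are now read modulo powers of \<open>s\<close> on the left and of \<open>t\<close>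
  on the right.\<close>

definition "steps_t =
  [Quadratic 0 [s, t, s] t' [t, u, s, t']
     (1, [u', t', t', s', t', t']) (0, [s, t, t, u, s]),
   Quadratic 0 [s'] u' [s, u, t, u, s]
     (1, [s', t', s', s', u', t', t']) (0, [s, t, u, s, s, t']),
   Quadratic 1 [u'] t' [s', u', t', s', s']
     (1, [t', s', u', t', t']) (0, [s, t, t, u, s, t]),
   Quadratic 1 [t', s'] t [s', u', t]
     (0, [s, t, u, s, s, t, t, t]) (1, [t', s', s', u', t]),
   Quadratic 1 [t'] s [t, s', u', t]
     (1, [t', s', t, s', u', t]) (1, [s', u', t]),
   Quadratic 1 [s] t [s, t, s', u', t]
     (1, [s, t', s, t, s', u', t]) (1, [s, s, t, s', u', t]),
   Quadratic 1 [u'] t [u, s, s, t, t]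
     (1, [s, t, s, t, s', u', t]) (1, [s, s, t, t]),
   Quadratic 1 [t, u] t [s, t, t]
     (1, [s', u', t, u, s, s, t, t]) (1, [t, u, s, t, t]),
   Quadratic 1 [u'] t [t', s', u']
     (0, [s, t, t, u, s, t, t]) (1, [t', s', u', t']),
   Quadratic 1 [u'] s [u', t]
     (1, [u', t, t', s', u', t]) (1, [u', u', t]),
   Quadratic 1 [] u [s, u']
     (1, [u', s, u', t, t']) (1, [s, u']),
   Quadratic 1 [t'] s [u, s, t]
     (1, [u, s, u']) (1, [t', u, s, t]),
   Quadratic 1 [] t [s, u, s, t, t]
     (1, [t', s, u, s, t, t]) (1, [s, u, s, t, t]),
   Quadratic 0 [s, t, s] t [t, u, t', t']
     (0, [s, t, s, u, t', t']) (1, [u', t', s', u', t', s', s', t', t']),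
   Quadratic 1 [u'] t [t', s', t', s', t', t']
     (0, [s, t, s, t, t, u, t', t']) (0, [s, s, t, t, u, s, t']),
   Quadratic 1 [s', u'] s [t', s', t']
     (1, [s', u', t, t', s', t', s', t', t', t]) (1, [t', s', u', t', t']),
   Quadratic 1 [s'] u [s, t', s']
     (1, [s', u', s, t', s', t', t]) (1, [t', s']),
   Quadratic 1 [t'] s [t, u, t]
     (1, [s, s', u, s, t', s', t]) (1, [u, t]),
   Quadratic 1 [] t [s, t, u, t]
     (1, [t', s, t, u, t]) (1, [s, t, u, t]),
   Braid (0, [t, s, t, u]) (1, [s', u', t', s', u', t', s', s']),
   Braid (0, [t, s, u, s]) (0, [s', s, t, s, t', t, u, s, t', t]),
   Braid (0, [t, u, t, s]) (0, [s', u', s, u, t, u, s, t])]"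

text \<open>With \<open>s\<close> and \<open>t\<close> both stable, only the part of a word from its
  first letter \<open>u\<close> or \<open>u'\<close> on matters, up to trailing powers of
  \<open>t\<close>.\<close>

definition "steps_u =
  [Quadratic 0 [u] s' [s, t, u, t']
     (1, [t', s', t', t', s', u', t', t']) (0, [t, u, s]),
   Quadratic 1 [] u [t, u]
     (1, [s, t, u, t', s']) (1, [t, u]),
   Quadratic 1 [s, t, t] u [t', s, u]
     (1, [s, t, t, s, t, t, u', t', s']) (1, [s, t, s, u]),
   Quadratic 1 [t, u] t [s, u]
     (1, [t', s', s, t, t, u, t', s, u]) (1, [s', t, t, u, s, t]),
   Quadratic 0 [u] s' [s, t, s, u]
     (1, [t', s', t', s', t, u', t', s']) (1, [t', t', s', u', u', t', s']),
   Braid (0, [u, s, u]) (0, [t', s', t, t, u, s, t]),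
   Braid (0, [u, t, u]) (0, [u, s', s, t, u, t', t]),
   Braid (0, [u, s, t, u]) (0, [s, t, u, s]),
   Braid (0, [u, s, u, s]) (1, [t', s', s', t', s', u', t', t']),
   Braid (0, [u, t, s, u]) (0, [u, s', s, t, s, u]),
   Braid (0, [u, t, u, s]) (0, [s, t, u, s, s, t']),
   Braid (1, [u, s, u]) (1, [t', s', t, t, u, s, t]),
   Braid (1, [u, s, t, u]) (1, [s, t, u, s]),
   Braid (1, [u, s, u, s]) (1, [t', s', t, s, t, u, s, s]),
   Braid (1, [u, t, u, s]) (1, [s, t, u, s, s, t'])]"

end

text \<open>A finite computation, starting with no stable generator and no derived braid.\<close>

lemma certificate: "certifies [] [] [(S, steps_s), (T, steps_t), (U, steps_u)]"
  by code_simp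

theorem theorem4p3p28:
  shows "(UNIV :: hecke set) =
    (\<Sum>k\<in>{0..1::nat}.
        {z ^ k} \<odot> u1 \<odot> u3 \<odot> u1 \<odot> u2
      + {z ^ k} \<odot> u1 \<odot> u2 \<odot> u3 \<odot> u2
      + {z ^ k} \<odot> u2 \<odot> u3 \<odot> u1 \<odot> u2
      + {z ^ k} \<odot> u2 \<odot> u1 \<odot> u3 \<odot> u2
      + {z ^ k} \<odot> u3 \<odot> u2 \<odot> u1 \<odot> u2)"
proof -
  have "left_stable []" by (simp add: left_stable_def)
  then have "pattern_span = UNIV" by (rule certifies_sound[OF _ _ certificate]) simp
  then show ?thesis by (simp only: pattern_span_eq)
qed

end
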